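(* Let $a\ge 2$, $n=2^a$, and let $\mathcal{S}$ be a normalized unitary-weight single-symbol decodable STBC of maximal rate, i.e. with $k=2a$ complex symbols and weight matrices $A_{1I}=I_n, A_{1Q}, A_{iI}, A_{iQ}$ ($2\le i\le 2a$). Then $$A_{1Q}=A_{1Q}^H\ (\text{equivalently } A_{1Q}^2=I_n),\qquad A_{iI}A_{1Q}=A_{1Q}A_{iI},\qquad A_{iQ}=\pm A_{iI}A_{1Q}$$ for $i=2,3,\dots,2a$.
   Context: A linear square STBC with $k$ complex symbols is given by $2k$ weight matrices $A_{iI},A_{iQ}\in\mathbb{C}^{n\times n}$ ($1\le i\le k$), linearly independent over $\mathbb{R}$, with codewords $S=\sum_{i=1}^k(x_{iI}A_{iI}+x_{iQ}A_{iQ})$. It is a unitary-weight single-symbol decodable (SSD) code if: (i) $A_{iI}^HA_{iI}=A_{iQ}^HA_{iQ}=I_n$ for all $i$; (ii) for all $1\le i\ne j\le k$: $A_{iI}^HA_{jQ}+A_{jQ}^HA_{iI}=O_n$, $A_{iI}^HA_{jI}+A_{jI}^HA_{iI}=O_n$, $A_{iQ}^HA_{jQ}+A_{jQ}^HA_{iQ}=O_n$; and (iii) it is not the case that $A_{iI}^HA_{iQ}+A_{iQ}^HA_{iI}=O_n$ for all $i$. It is normalized if $A_{1I}=I_n$. For $n=2^a$ the rate of such a code is at most $2a/2^a$, so maximal rate means $k=2a$. *)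

theory Defs
  imports "Jordan_Normal_Form.Schur_Decomposition"
begin

definition real_lin_indep_weights ::
  "nat \<Rightarrow> nat \<Rightarrow> (nat \<Rightarrow> complex mat) \<Rightarrow> (nat \<Rightarrow> complex mat) \<Rightarrow> bool" where
  "real_lin_indep_weights n k AI AQ \<longleftrightarrow>
     (\<forall>c d :: nat \<Rightarrow> real.
        (\<forall>r<n. \<forall>s<n. (\<Sum>i\<in>{1..k}. complex_of_real (c i) * AI i $$ (r,s)
                                     + complex_of_real (d i) * AQ i $$ (r,s)) = 0)
        \<longrightarrow> (\<forall>i\<in>{1..k}. c i = 0 \<and> d i = 0))"

definition unitary_weight_SSD ::
  "nat \<Rightarrow> nat \<Rightarrow> (nat \<Rightarrow> complex mat) \<Rightarrow> (nat \<Rightarrow> complex mat) \<Rightarrow> bool" where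
  "unitary_weight_SSD n k AI AQ \<longleftrightarrow>
     (\<forall>i\<in>{1..k}. AI i \<in> carrier_mat n n \<and> AQ i \<in> carrier_mat n n) \<and>
     real_lin_indep_weights n k AI AQ \<and>
     (\<forall>i\<in>{1..k}. mat_adjoint (AI i) * AI i = 1\<^sub>m n \<and> mat_adjoint (AQ i) * AQ i = 1\<^sub>m n) \<and>
     (\<forall>i\<in>{1..k}. \<forall>j\<in>{1..k}. i \<noteq> j \<longrightarrow>
        mat_adjoint (AI i) * AQ j + mat_adjoint (AQ j) * AI i = 0\<^sub>m n n \<and>
        mat_adjoint (AI i) * AI j + mat_adjoint (AI j) * AI i = 0\<^sub>m n n \<and>
        mat_adjoint (AQ i) * AQ j + mat_adjoint (AQ j) * AQ i = 0\<^sub>m n n) \<and>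
     \<not> (\<forall>i\<in>{1..k}. mat_adjoint (AI i) * AQ i + mat_adjoint (AQ i) * AI i = 0\<^sub>m n n)"

definition normalized_STBC :: "nat \<Rightarrow> (nat \<Rightarrow> complex mat) \<Rightarrow> bool" where
  "normalized_STBC n AI \<longleftrightarrow> AI 1 = 1\<^sub>m n"

end

theory Submission
  imports Defs
begin

text \<open>
  Write \<open>B i\<close>, \<open>C i\<close> for the in-phase and quadrature weight matrices with \<open>i \<ge> 2\<close> and \<open>D\<close> for the
  quadrature matrix of the first symbol. The \<open>B i\<close> are \<open>2a - 1\<close> anticommuting skew-Hermitian
  unitaries, and \<open>C i\<close> anticommutes with every \<open>B j\<close>, \<open>j \<noteq> i\<close>. In dimension \<open>2^a\<close>, a matrix that
  commutes with \<open>2a - 2\<close> such generators and with a non-scalar Hermitian involution \<open>N\<close>, which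
  itself commutes with the generators, lies in the span of the identity and \<open>N\<close>: the generators
  act irreducibly on both eigenspaces of \<open>N\<close>.

  Let \<open>F\<close> be the difference of \<open>D\<close> and its adjoint; it anticommutes with all \<open>B i\<close> and \<open>C i\<close>. If
  \<open>F\<close> were nonzero, its square would be a scalar, so after scaling \<open>F\<close> would be a further generator,
  and every \<open>C i\<close> would be a combination of \<open>B i\<close> and one product \<open>Z\<close> of all generators. Since
  \<open>C 2\<close> and \<open>C 3\<close> anticommute, one of them would be a multiple of \<open>B 2\<close> or \<open>B 3\<close>, against linear
  independence. Hence \<open>D\<close> is a Hermitian involution commuting with everything, and the span
  statement for \<open>B i C i\<close> with \<open>N = D\<close> gives \<open>C i = \<plusminus> B i D\<close>.
\<close>

section \<open>Adjoint, trace and diagonal matrix units\<close>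

lemma mat_adjoint_carrier [simp]:
  "A \<in> carrier_mat m n \<Longrightarrow> mat_adjoint A \<in> carrier_mat n m"
  unfolding mat_adjoint_def by auto

lemma mat_adjoint_dim [simp]:
  "dim_row (mat_adjoint A) = dim_col A" "dim_col (mat_adjoint A) = dim_row A"
  unfolding mat_adjoint_def by auto

lemma mat_adjoint_index [simp]:
  fixes A :: "complex mat"
  assumes "i < dim_col A" "j < dim_row A"
  shows "mat_adjoint A $$ (i, j) = cnj (A $$ (j, i))"
  using assms unfolding mat_adjoint_def by (simp add: mat_of_rows_def)

definition mtrace :: "complex mat \<Rightarrow> complex" where
  "mtrace A = (\<Sum>i<dim_row A. A $$ (i, i))"

definition unit_mat :: "nat \<Rightarrow> nat \<Rightarrow> complex mat" where
  "unit_mat n c = mat n n (\<lambda>(i, j). if i = c \<and> j = c then 1 else 0)"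

section \<open>Arithmetic, adjoints and traces in a fixed dimension\<close>

locale square_mats =
  fixes n :: nat
begin

abbreviation M :: "complex mat set" where "M \<equiv> carrier_mat n n"
abbreviation I :: "complex mat" where "I \<equiv> 1\<^sub>m n"

lemma smult_smult [simp]: "a \<cdot>\<^sub>m (b \<cdot>\<^sub>m (A :: complex mat)) = (a * b) \<cdot>\<^sub>m A"
  by (intro eq_matI) auto

lemma one_smult [simp]: "1 \<cdot>\<^sub>m (A :: complex mat) = A"
  by (intro eq_matI) auto

lemma uminus_smult [simp]:
  "- (a \<cdot>\<^sub>m A) = (- a) \<cdot>\<^sub>m (A :: complex mat)" "a \<cdot>\<^sub>m (- A) = (- a) \<cdot>\<^sub>m A"
  by (auto intro!: eq_matI)

lemma minus_one_smult [simp]: "(- 1) \<cdot>\<^sub>m (A :: complex mat) = - A"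
  by (intro eq_matI) auto

lemma smult_eq_iff:
  assumes "A \<in> M" "B \<in> M" "a \<noteq> 0"
  shows "a \<cdot>\<^sub>m A = a \<cdot>\<^sub>m B \<longleftrightarrow> A = B"
proof
  assume "a \<cdot>\<^sub>m A = a \<cdot>\<^sub>m B"
  then have "(1 / a) \<cdot>\<^sub>m (a \<cdot>\<^sub>m A) = (1 / a) \<cdot>\<^sub>m (a \<cdot>\<^sub>m B)" by simp
  then show "A = B" using assms by simp
qed simp

lemma mult_carrier [simp]: "A \<in> M \<Longrightarrow> B \<in> M \<Longrightarrow> A * B \<in> M"
  by (rule mult_carrier_mat)

lemma minus_carrier [simp]: "B \<in> M \<Longrightarrow> A - B \<in> M"
  by (rule minus_carrier_mat)

lemma uminus_mult [simp]:
  assumes "A \<in> M" "B \<in> M"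
  shows "- A * B = - (A * B)" "A * - B = - (A * B)"
  using assms by (auto intro!: uminus_mult_left_mat uminus_mult_right_mat)

lemmas one_mult [simp] = left_mult_one_mat[of _ n n] right_mult_one_mat[of _ n n]
lemmas add_zero [simp] = left_add_zero_mat[of _ n n] right_add_zero_mat[of _ n n]
lemmas zero_mult [simp] = left_mult_zero_mat[of _ n n] right_mult_zero_mat[of _ n n]
lemmas assoc [simp] = assoc_mult_mat[of _ n n _ n _ n]
lemmas smult_mult [simp] = mult_smult_assoc_mat[of _ n n _ n] mult_smult_distrib[of _ n n _ n]
lemmas distribs = add_mult_distrib_mat[of _ n n _ _ n] mult_add_distrib_mat[of _ n n _ n]
  minus_mult_distrib_mat[of _ n n _ _ n] mult_minus_distrib_mat[of _ n n _ n]
  add_smult_distrib_left_mat[of _ n n]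

lemma minus_eq_0_iff:
  assumes "A \<in> M" "B \<in> M"
  shows "A - B = 0\<^sub>m n n \<longleftrightarrow> A = B"
proof
  assume eq: "A - B = 0\<^sub>m n n"
  show "A = B"
  proof (rule eq_matI)
    fix i j assume "i < dim_row B" "j < dim_col B"
    then show "A $$ (i, j) = B $$ (i, j)"
      using arg_cong[OF eq, of "\<lambda>X. X $$ (i, j)"] assms by auto
  qed (use assms in auto)
qed (use assms in auto)

lemma add_eq_0_iff:
  assumes "A \<in> M" "B \<in> M"
  shows "A + B = 0\<^sub>m n n \<longleftrightarrow> A = - B"
proof -
  have "A + B = A - (- B)" using assms by (intro eq_matI) auto
  then show ?thesis using minus_eq_0_iff[of A "- B"] assms by simp
qed

lemma adj_mult [simp]:
  assumes "A \<in> M" "B \<in> M"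
  shows "mat_adjoint (A * B) = mat_adjoint B * mat_adjoint A"
  using assms by (intro eq_matI) (auto simp: scalar_prod_def mult.commute)

lemma adj_linear [simp]:
  "A \<in> M \<Longrightarrow> B \<in> M \<Longrightarrow> mat_adjoint (A + B) = mat_adjoint A + mat_adjoint B"
  "A \<in> M \<Longrightarrow> B \<in> M \<Longrightarrow> mat_adjoint (A - B) = mat_adjoint A - mat_adjoint B"
  "A \<in> M \<Longrightarrow> mat_adjoint (- A) = - mat_adjoint A"
  "A \<in> M \<Longrightarrow> mat_adjoint (a \<cdot>\<^sub>m A) = cnj a \<cdot>\<^sub>m mat_adjoint A"
  by (auto intro!: eq_matI)

lemma adj_adj [simp]: "mat_adjoint (mat_adjoint A) = (A :: complex mat)"
  by (intro eq_matI) auto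

lemma adj_one [simp]: "mat_adjoint I = I"
  by (intro eq_matI) auto

lemma trace_linear [simp]:
  "A \<in> M \<Longrightarrow> B \<in> M \<Longrightarrow> mtrace (A + B) = mtrace A + mtrace B"
  "A \<in> M \<Longrightarrow> B \<in> M \<Longrightarrow> mtrace (A - B) = mtrace A - mtrace B"
  "A \<in> M \<Longrightarrow> mtrace (- A) = - mtrace A"
  "A \<in> M \<Longrightarrow> mtrace (a \<cdot>\<^sub>m A) = a * mtrace A"
  "mtrace I = of_nat n"
  by (auto simp: mtrace_def sum.distrib sum_subtractf sum_negf sum_distrib_left)

lemma trace_comm:
  assumes "A \<in> M" "B \<in> M"
  shows "mtrace (A * B) = mtrace (B * A)"
proof -
  have "mtrace (A * B) = (\<Sum>i<n. \<Sum>j<n. A $$ (i, j) * B $$ (j, i))"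
    using assms by (auto simp: mtrace_def scalar_prod_def atLeast0LessThan)
  also have "\<dots> = (\<Sum>j<n. \<Sum>i<n. B $$ (j, i) * A $$ (i, j))"
    by (subst sum.swap) (simp add: mult.commute)
  also have "\<dots> = mtrace (B * A)"
    using assms by (auto simp: mtrace_def scalar_prod_def atLeast0LessThan)
  finally show ?thesis .
qed

text \<open>The squared Frobenius norm of \<open>A\<close>; it makes the trace form positive
  definite.\<close>

lemma trace_gram:
  assumes "A \<in> M"
  shows "mtrace (mat_adjoint A * A) = of_real (\<Sum>i<n. \<Sum>j<n. (cmod (A $$ (j, i)))\<^sup>2)"
  using assms unfolding mtrace_def
  by (auto simp: scalar_prod_def atLeast0LessThan complex_norm_square[unfolded of_real_power]
      mult.commute intro!: sum.cong)

lemma Re_trace_gram_nonneg: "A \<in> M \<Longrightarrow> 0 \<le> Re (mtrace (mat_adjoint A * A))"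
  by (simp add: trace_gram sum_nonneg)

lemma trace_gram_eq_0_D:
  assumes "A \<in> M" "Re (mtrace (mat_adjoint A * A)) = 0"
  shows "A = 0\<^sub>m n n"
proof -
  have "\<forall>i<n. \<forall>j<n. A $$ (j, i) = 0"
    using assms by (simp add: trace_gram sum_nonneg sum_nonneg_eq_0_iff)
  then show ?thesis using assms by (intro eq_matI) auto
qed

section \<open>Orthogonal projections and their traces\<close>

definition projection :: "complex mat \<Rightarrow> bool" where
  "projection P \<longleftrightarrow> P \<in> M \<and> mat_adjoint P = P \<and> P * P = P"

lemma projectionD:
  assumes "projection P"
  shows "P \<in> M" "mat_adjoint P = P" "P * P = P" "A \<in> M \<Longrightarrow> P * (P * A) = P * A"
  using assms assoc[of P P A] by (simp_all add: projection_def del: assoc)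

text \<open>Since \<open>P\<close> equals its adjoint times itself, its trace is a squared Frobenius
  norm.\<close>

lemma projection_trace:
  assumes "projection P"
  shows "0 \<le> Re (mtrace P)" "Re (mtrace P) = 0 \<Longrightarrow> P = 0\<^sub>m n n"
  using Re_trace_gram_nonneg[of P] trace_gram_eq_0_D[of P] projectionD[OF assms] by auto

lemma unit_mat_carrier [simp]: "unit_mat n c \<in> M"
  by (simp add: unit_mat_def)

lemma unit_mat_sandwich:
  assumes "A \<in> M" "c < n"
  shows "unit_mat n c * (A * unit_mat n c) = A $$ (c, c) \<cdot>\<^sub>m unit_mat n c"
  using assms
  by (intro eq_matI) (auto simp: unit_mat_def scalar_prod_def if_distrib[of "\<lambda>x. x * _"]
      if_distrib[of "\<lambda>x. _ * x"] cong: if_cong)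

lemma adj_unit_mat [simp]: "mat_adjoint (unit_mat n c) = unit_mat n c"
  by (intro eq_matI) (auto simp: unit_mat_def)

lemma trace_unit_mat_mult:
  assumes "A \<in> M" "c < n"
  shows "mtrace (unit_mat n c * A) = A $$ (c, c)"
proof -
  have "mtrace (unit_mat n c * A) = (\<Sum>i<n. \<Sum>j<n. if i = c then if j = c then A $$ (c, c) else 0 else 0)"
    using assms unfolding mtrace_def
    by (auto simp: unit_mat_def scalar_prod_def atLeast0LessThan intro!: sum.cong)
  also have "\<dots> = (\<Sum>i<n. if i = c then A $$ (c, c) else 0)"
    using assms by (intro sum.cong) auto
  finally show ?thesis using assms by simp
qed

text \<open>With \<open>E\<close> the matrix unit at a nonzero diagonal entry \<open>p\<close> of \<open>P\<close>, the matrix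
  \<open>P E P / p\<close> is a rank one projection below \<open>P\<close>.\<close>

lemma nonzero_projection:
  assumes P: "projection P" and nz: "P \<noteq> 0\<^sub>m n n"
  shows "1 \<le> Re (mtrace P)"
    and "Re (mtrace P) = 1 \<Longrightarrow> X \<in> M \<Longrightarrow> \<exists>c. P * (X * P) = c \<cdot>\<^sub>m P"
proof -
  note [simp] = projectionD[OF P]
  have "Re (mtrace P) \<noteq> 0" using projection_trace(2)[OF P] nz by blast
  then have "mtrace P \<noteq> 0" by auto
  then obtain c where c: "c < n" "P $$ (c, c) \<noteq> 0"
    unfolding mtrace_def using projectionD(1)[OF P] by (auto dest: sum.not_neutral_contains_not_neutral)
  define p where "p = P $$ (c, c)"
  define E where "E = unit_mat n c"
  have E [simp]: "E \<in> M" "mat_adjoint E = E" by (auto simp: E_def)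
  have p: "p \<noteq> 0" using c by (simp add: p_def)
  \<comment> \<open>The diagonal of a Hermitian matrix is real; this makes \<open>R\<close> below
    Hermitian.\<close>
  have "cnj p = mat_adjoint P $$ (c, c)"
    using c carrier_matD[OF projectionD(1)[OF P]] by (subst mat_adjoint_index) (auto simp: p_def)
  then have cnj_p [simp]: "cnj p = p" by (simp add: p_def)
  have sandwich: "E * (A * (E * B)) = A $$ (c, c) \<cdot>\<^sub>m (E * B)" if "A \<in> M" "B \<in> M" for A B
  proof -
    have "E * (A * (E * B)) = (E * (A * E)) * B" using that by simp
    then show ?thesis using that unit_mat_sandwich[of A c] c by (simp add: E_def del: assoc)
  qed
  define R where "R = (1 / p) \<cdot>\<^sub>m (P * (E * P))"
  have R [simp]: "R \<in> M" "mat_adjoint R = R" by (auto simp: R_def)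
  have PR [simp]: "P * R = R" "R * P = R" by (auto simp: R_def)
  have RR [simp]: "R * R = R"
    using p by (simp add: R_def sandwich p_def[symmetric])
  have "mtrace (P * (E * P)) = mtrace (E * P)" using trace_comm[of P "E * P"] by simp
  also have "\<dots> = p" using trace_unit_mat_mult[of P c] c by (simp add: E_def p_def)
  finally have trR: "mtrace R = 1" using p by (simp add: R_def)
  \<comment> \<open>What remains of \<open>P\<close> is again a projection, with trace smaller by
    one. Its trace is nonnegative and vanishes only for \<open>P = R\<close>, which yields both
    claims.\<close>
  have "(P - R) * (P - R) = P - R - (R - R)" by (simp add: distribs)
  also have "\<dots> = P - R" using R(1) projectionD(1)[OF P] by (intro eq_matI) auto
  finally have diff: "projection (P - R)" by (simp add: projection_def)
  have tr: "Re (mtrace P) = 1 + Re (mtrace (P - R))" using trR by simp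
  show "1 \<le> Re (mtrace P)" using projection_trace(1)[OF diff] tr by linarith
  assume "Re (mtrace P) = 1" and X [simp]: "X \<in> M"
  then have "P - R = 0\<^sub>m n n" using projection_trace(2)[OF diff] tr by linarith
  then have PR_eq: "P = R" by (simp add: minus_eq_0_iff)
  have "P * (X * P) = (1 / p) \<cdot>\<^sub>m (P * (E * P)) * (X * ((1 / p) \<cdot>\<^sub>m (P * (E * P))))"
    using PR_eq R_def by metis
  also have "\<dots> = (1 / p\<^sup>2) \<cdot>\<^sub>m (P * (E * ((P * (X * P)) * (E * P))))"
    by (simp add: power2_eq_square)
  also have "\<dots> = ((P * (X * P)) $$ (c, c) / p) \<cdot>\<^sub>m R"
    by (subst sandwich) (simp_all add: R_def power2_eq_square)
  finally show "\<exists>c. P * (X * P) = c \<cdot>\<^sub>m P" using PR_eq by metis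
qed

text \<open>Simplification nests products to the right, which hides the pair \<open>A * B\<close>
  inside a longer product; relations are therefore needed with a tail \<open>X\<close>.\<close>

lemma mult_left_eq:
  assumes "A * B = C" "A \<in> M" "B \<in> M" "X \<in> M"
  shows "A * (B * X) = C * X"
  using assms assoc[of A B X] by (simp del: assoc)

lemma half_sum:
  assumes "A \<in> M" "B \<in> M"
  shows "(1/2) \<cdot>\<^sub>m (A + B) + (1/2) \<cdot>\<^sub>m (A - B) = (A :: complex mat)"
  using assms by (intro eq_matI) (auto simp: field_simps)

text \<open>The matrix \<open>(I + T) / 2\<close> projects onto the eigenspace of \<open>T\<close>
  for the eigenvalue 1; it commutes with \<open>P\<close>, so its product with \<open>P\<close> is a
  projection.\<close>

lemma half_projection:
  assumes P: "projection P"
    and T: "T \<in> M" "mat_adjoint T = T" "T * T = I" "T * P = P * T"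
  shows "projection ((1/2) \<cdot>\<^sub>m (P + T * P))"
proof -
  note [simp] = projectionD[OF P] T(1-3) T(4)[symmetric]
  have [simp]: "P * (T * A) = T * (P * A)" "T * (T * A) = A" if "A \<in> M" for A
    using mult_left_eq[of P T "T * P" A] mult_left_eq[of T T I A] that by simp_all
  have quarter: "(1/4) \<cdot>\<^sub>m (A + B + (B + A)) = (1/2) \<cdot>\<^sub>m (A + B)" if "A \<in> M" "B \<in> M" for A B
    using that by (intro eq_matI) (auto simp: field_simps)
  have "(P + T * P) * (P + T * P) = P + T * P + (T * P + P)"
    by (simp add: distribs)
  then have "((1/2) \<cdot>\<^sub>m (P + T * P)) * ((1/2) \<cdot>\<^sub>m (P + T * P)) = (1/2) \<cdot>\<^sub>m (P + T * P)"
    by (simp add: quarter)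
  then show ?thesis by (simp add: projection_def)
qed

section \<open>Clifford generators and their commutants\<close>

text \<open>A list rather than a set, since it fixes the order of the factors in
  \<open>mprod\<close>; \<open>sorted_wrt\<close> imposes anticommutation once for each pair of
  positions.\<close>

definition clifford :: "complex mat list \<Rightarrow> bool" where
  "clifford es \<longleftrightarrow>
     (\<forall>e\<in>set es. e \<in> M \<and> mat_adjoint e = - e \<and> e * e = - I) \<and>
     sorted_wrt (\<lambda>x y. x * y = - (y * x)) es"

lemma clifford_Cons:
  "clifford (e # es) \<longleftrightarrow>
     e \<in> M \<and> mat_adjoint e = - e \<and> e * e = - I \<and>
     (\<forall>f\<in>set es. e * f = - (f * e)) \<and> clifford es"
  by (auto simp: clifford_def)

lemma cliffordD:
  assumes "clifford es" "e \<in> set es"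
  shows "e \<in> M" "mat_adjoint e = - e" "e * e = - I"
  using assms by (auto simp: clifford_def)

text \<open>The projections \<open>(I \<plusminus> \<i> e f) / 2\<close> cut \<open>P\<close> into two halves that are exchanged by
  conjugation with \<open>e\<close>, which allows induction on the number of pairs of generators.\<close>

lemma clifford_irreducible:
  assumes "clifford es" "length es = 2 * l" "projection P" "P \<noteq> 0\<^sub>m n n"
    and "\<forall>e\<in>set es. e * P = P * e"
  shows "2 ^ l \<le> Re (mtrace P) \<and>
    (Re (mtrace P) = 2 ^ l \<longrightarrow>
      (\<forall>X\<in>M. (\<forall>e\<in>set es. e * X = X * e) \<longrightarrow> X * P = P * X \<longrightarrow> (\<exists>c. X * P = c \<cdot>\<^sub>m P)))"
  using assms
proof (induction l arbitrary: es P)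
  case 0
  note P = projectionD[OF 0(3)]
  have "\<exists>c. X * P = c \<cdot>\<^sub>m P" if "Re (mtrace P) = 1" "X \<in> M" "X * P = P * X" for X
  proof -
    have "X * P = P * (X * P)" using that P by simp
    then show ?thesis using nonzero_projection(2)[OF 0(3,4) that(1,2)] by simp
  qed
  then show ?case using nonzero_projection(1)[OF 0(3,4)] by simp
next
  case (Suc l)
  obtain e f gs where es: "es = e # f # gs" and len: "length gs = 2 * l"
    using Suc.prems(2) by (cases es; cases "tl es") auto
  note P = projectionD[OF Suc.prems(3)]
  note [simp] = P
  have gs: "clifford gs" and [simp]: "e \<in> M" "f \<in> M" "mat_adjoint e = - e" "mat_adjoint f = - f"
      "e * e = - I" "f * f = - I" "f * e = - (e * f)"
    and eg: "\<And>g. g \<in> set gs \<Longrightarrow> e * g = - (g * e)" and fg: "\<And>g. g \<in> set gs \<Longrightarrow> f * g = - (g * f)"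
    using Suc.prems(1) unfolding es by (auto simp: clifford_Cons)
  have [simp]: "P * e = e * P" "P * f = f * P" and Pg: "\<And>g. g \<in> set gs \<Longrightarrow> g * P = P * g"
    using Suc.prems(5) unfolding es by auto
  have [simp]: "e * (e * A) = - A" "f * (f * A) = - A" "f * (e * A) = - (e * (f * A))"
      "P * (e * A) = e * (P * A)" "P * (f * A) = f * (P * A)" if "A \<in> M" for A
    using that mult_left_eq[of e e "- I" A] mult_left_eq[of f f "- I" A]
      mult_left_eq[of f e "- (e * f)" A] mult_left_eq[of P e "e * P" A] mult_left_eq[of P f "f * P" A]
    by simp_all
  \<comment> \<open>The product \<open>e * f\<close> is skew-Hermitian with square
    \<open>- I\<close>; the factor \<open>\<i>\<close> turns it into a Hermitian involution.\<close>
  define T where "T = \<i> \<cdot>\<^sub>m (e * f)"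
  have T: "T \<in> M" "mat_adjoint T = T" "T * T = I" "T * P = P * T" "e * T = - (T * e)"
    by (simp_all add: T_def)
  define Q where "Q = (1/2) \<cdot>\<^sub>m (P + T * P)"
  define R where "R = (1/2) \<cdot>\<^sub>m (P - T * P)"
  have Q: "projection Q" unfolding Q_def by (intro half_projection Suc.prems T)
  have [simp]: "Q \<in> M" "R \<in> M" by (simp_all add: Q_def R_def T)
  have QR: "Q + R = P"
    unfolding Q_def R_def by (rule half_sum) (simp_all add: T)
  \<comment> \<open>As \<open>- e\<close> is the inverse of \<open>e\<close>, this is a conjugation.
    Both halves thus have the same trace, half of that of \<open>P\<close>.\<close>
  have conj: "R = - (e * (Q * e))"
  proof -
    have "- (e * ((P + T * P) * e)) = P - T * P"
      using carrier_matD[OF P(1)] carrier_matD[OF T(1)] by (simp add: distribs T_def) (auto intro!: eq_matI)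
    from arg_cong[OF this, of "\<lambda>A. (1/2) \<cdot>\<^sub>m A"]
    show ?thesis using T(1) by (simp add: Q_def R_def)
  qed
  have "mtrace R = mtrace Q"
    using trace_comm[of e "Q * e"] by (simp add: conj)
  then have tr: "Re (mtrace P) = 2 * Re (mtrace Q)"
    using QR trace_linear(1)[of Q R] by simp
  have "Q \<noteq> 0\<^sub>m n n"
  proof
    assume "Q = 0\<^sub>m n n"
    moreover from this have "R = 0\<^sub>m n n" unfolding conj by (auto intro!: eq_matI)
    ultimately show False using QR Suc.prems(4) by simp
  qed
  moreover have "g * Q = Q * g" if g: "g \<in> set gs" for g
  proof -
    have [simp]: "g \<in> M" using cliffordD[OF gs g] by simp
    note [simp] = eg[OF g] fg[OF g] Pg[OF g, symmetric]
    have [simp]: "e * (g * A) = - (g * (e * A))" "f * (g * A) = - (g * (f * A))" if "A \<in> M" for A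
      using that mult_left_eq[of e g "- (g * e)" A] mult_left_eq[of f g "- (g * f)" A] by simp_all
    \<comment> \<open>The signs from passing \<open>e\<close> and \<open>f\<close> cancel.\<close>
    have "T * g = g * T" by (simp add: T_def)
    then have "T * (P * g) = g * (T * P)"
      using mult_left_eq[of T g "g * T" P] T(1) by simp
    then show ?thesis using T(1) by (simp add: Q_def distribs)
  qed
  ultimately have IH: "2 ^ l \<le> Re (mtrace Q)"
    "Re (mtrace Q) = 2 ^ l \<Longrightarrow> X \<in> M \<Longrightarrow> \<forall>g\<in>set gs. g * X = X * g \<Longrightarrow> X * Q = Q * X \<Longrightarrow>
      \<exists>c. X * Q = c \<cdot>\<^sub>m Q" for X
    using Suc.IH[OF gs len Q] by blast+
  have "\<exists>c. X * P = c \<cdot>\<^sub>m P"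
    if trP: "Re (mtrace P) = 2 ^ Suc l" and X: "X \<in> M" "\<forall>e\<in>set es. e * X = X * e" "X * P = P * X" for X
  proof -
    note [simp] = X(1,3)
    have [simp]: "X * e = e * X" "X * f = f * X" and Xg: "\<forall>g\<in>set gs. g * X = X * g"
      using X(2) unfolding es by auto
    have [simp]: "X * (e * A) = e * (X * A)" "X * (f * A) = f * (X * A)" if "A \<in> M" for A
      using that mult_left_eq[of X e "e * X" A] mult_left_eq[of X f "f * X" A] by simp_all
    have "X * Q = Q * X" by (simp add: Q_def T_def distribs)
    then obtain c where c: "X * Q = c \<cdot>\<^sub>m Q"
      using IH(2)[OF _ X(1) Xg] tr trP by auto
    \<comment> \<open>Since \<open>X\<close> commutes with \<open>e\<close>, conjugation carries the
      scalar \<open>c\<close> from \<open>Q\<close> to \<open>R\<close>.\<close>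
    then have "X * R = c \<cdot>\<^sub>m R"
      using mult_left_eq[OF c, of e] by (simp add: conj)
    then have "X * (Q + R) = c \<cdot>\<^sub>m (Q + R)"
      using c by (simp add: distribs)
    then show ?thesis unfolding QR by blast
  qed
  then show ?case using IH(1) tr by auto
qed

text \<open>Both eigenprojections of \<open>D\<close> are nonzero and commute with the generators,
  so each has trace at least \<open>2 ^ l\<close>. The traces add up to \<open>2 ^ Suc l\<close>,
  hence both are minimal, and \<open>X\<close> acts as a scalar on each eigenspace.\<close>

lemma commutant_even:
  assumes "clifford es" "length es = 2 * l" "n = 2 ^ Suc l"
    and D: "D \<in> M" "mat_adjoint D = D" "D * D = I" "D \<noteq> I" "D \<noteq> - I" "\<forall>e\<in>set es. e * D = D * e"
    and X: "X \<in> M" "\<forall>e\<in>set es. e * X = X * e" "X * D = D * X"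
  shows "\<exists>x y. X = x \<cdot>\<^sub>m I + y \<cdot>\<^sub>m D"
proof -
  note [simp] = D(1-3) X(1,3)
  have I: "projection I" by (simp add: projection_def)
  define P where "P = (1/2) \<cdot>\<^sub>m (I + D * I)"
  define Q where "Q = (1/2) \<cdot>\<^sub>m (I + (- D) * I)"
  have P: "P = (1/2) \<cdot>\<^sub>m (I + D)" by (simp add: P_def)
  have Q: "Q = (1/2) \<cdot>\<^sub>m (I - D)" by (simp add: Q_def minus_add_uminus_mat[of _ n n])
  have proj: "projection P" "projection Q"
    unfolding P_def Q_def using half_projection[OF I, of D] half_projection[OF I, of "- D"] by simp_all
  then have [simp]: "P \<in> M" "Q \<in> M" by (simp_all add: projection_def)
  have nz: "P \<noteq> 0\<^sub>m n n" "Q \<noteq> 0\<^sub>m n n"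
    using D(4,5) add_eq_0_iff[of D I] minus_eq_0_iff[of I D] comm_add_mat[of I n n D]
      smult_eq_iff[of "I + D" "0\<^sub>m n n" "1/2"] smult_eq_iff[of "I - D" "0\<^sub>m n n" "1/2"]
    by (auto simp: P Q)
  have es: "e \<in> M" if "e \<in> set es" for e using cliffordD[OF assms(1) that] by simp
  have comm: "e * P = P * e" "e * Q = Q * e" if "e \<in> set es" for e
    using D(6) es that by (simp_all add: P Q distribs)
  have XPQ: "X * P = P * X" "X * Q = Q * X" by (simp_all add: P Q distribs)
  have PQ: "P + Q = I" unfolding P Q by (rule half_sum) simp_all
  have "mtrace P + mtrace Q = of_nat n"
    using trace_linear(1)[of P Q] PQ by simp
  then have "Re (mtrace P) + Re (mtrace Q) = real n"
    by (metis Re_complex_of_real of_real_of_nat_eq plus_complex.sel(1))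
  then have "Re (mtrace P) + Re (mtrace Q) = 2 * 2 ^ l"
    using assms(3) by simp
  moreover note irrP = clifford_irreducible[OF assms(1,2) proj(1) nz(1)]
    and irrQ = clifford_irreducible[OF assms(1,2) proj(2) nz(2)]
  ultimately have "Re (mtrace P) = 2 ^ l" "Re (mtrace Q) = 2 ^ l"
    using comm by (smt (verit, best))+
  then obtain c d where c: "X * P = c \<cdot>\<^sub>m P" and d: "X * Q = d \<cdot>\<^sub>m Q"
    using irrP irrQ comm X XPQ by metis
  have "X = X * (P + Q)" by (simp add: PQ)
  also have "\<dots> = c \<cdot>\<^sub>m P + d \<cdot>\<^sub>m Q" by (simp add: distribs c d)
  also have "\<dots> = ((c + d) / 2) \<cdot>\<^sub>m I + ((c - d) / 2) \<cdot>\<^sub>m D"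
    using carrier_matD[OF D(1)] by (intro eq_matI) (auto simp: P Q field_simps)
  finally show ?thesis by blast
qed

section \<open>Products of generators\<close>

definition mprod :: "complex mat list \<Rightarrow> complex mat" where
  "mprod es = foldr (*) es I"

lemma mprod_simps [simp]: "mprod [] = I" "mprod (e # es) = e * mprod es"
  by (simp_all add: mprod_def)

lemma mprod_carrier: "set es \<subseteq> M \<Longrightarrow> mprod es \<in> M"
  by (induction es) auto

lemma clifford_mprod_carrier [simp]: "clifford es \<Longrightarrow> mprod es \<in> M"
  by (rule mprod_carrier) (auto dest: cliffordD)

lemma commute_mprod:
  assumes "X \<in> M" "set es \<subseteq> M" "\<forall>e\<in>set es. e * X = X * e"
  shows "mprod es * X = X * mprod es"
  using assms(2,3)
proof (induction es)
  case (Cons e es)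
  then have [simp]: "e \<in> M" "mprod es \<in> M" using mprod_carrier by auto
  show ?case using Cons assms(1) mult_left_eq[of e X "X * e" "mprod es"] by simp
qed (use assms in simp)

lemma anticommute_mprod:
  assumes "y \<in> M" "set es \<subseteq> M" "\<forall>e\<in>set es. y * e = - (e * y)"
  shows "y * mprod es = (- 1) ^ length es \<cdot>\<^sub>m (mprod es * y)"
  using assms(2,3)
proof (induction es)
  case (Cons e es)
  then have [simp]: "e \<in> M" "mprod es \<in> M" using mprod_carrier by auto
  show ?case using Cons assms(1) mult_left_eq[of y e "- (e * y)" "mprod es"] by simp
qed (use assms in simp)

text \<open>A generator passes every other factor with a sign and its own copy without one. This
  leaves \<open>length es - 1\<close> signs, written with \<open>Suc\<close> of the same parity to
  avoid truncated subtraction.\<close>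

lemma generator_mprod:
  assumes "clifford es" "e \<in> set es"
  shows "e * mprod es = (- 1) ^ Suc (length es) \<cdot>\<^sub>m (mprod es * e)"
  using assms
proof (induction es)
  case (Cons x es)
  note c = Cons.prems(1)[unfolded clifford_Cons]
  have [simp]: "x \<in> M" "mprod es \<in> M" using c by auto
  have sub: "set es \<subseteq> M" using c by (auto dest: cliffordD)
  show ?case
  proof (cases "e = x")
    case True
    have "x * mprod es = (- 1) ^ length es \<cdot>\<^sub>m (mprod es * x)"
      using anticommute_mprod[of x es] c sub by simp
    from arg_cong[OF this, of "\<lambda>A. x * A"]
    have "x * (x * mprod es) = (- 1) ^ length es \<cdot>\<^sub>m (x * (mprod es * x))"
      by (simp del: assoc)
    then show ?thesis using True by simp
  next
    case False
    then have e: "e \<in> set es" "e \<in> M" "e * x = - (x * e)" using Cons.prems(2) c sub by auto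
    have "e * (x * mprod es) = - (x * (e * mprod es))"
      using mult_left_eq[OF e(3)] e(2) by simp
    then show ?thesis using Cons.IH c e(1,2) by simp
  qed
qed simp

text \<open>Generators are unitary with square \<open>- I\<close>, and regrouping the factors costs
  only signs.\<close>

lemma mprod_square:
  assumes "clifford es"
  shows "mprod es * mprod es = I \<or> mprod es * mprod es = - I"
    and "mat_adjoint (mprod es) * mprod es = I"
proof -
  have "(mprod es * mprod es = I \<or> mprod es * mprod es = - I) \<and> mat_adjoint (mprod es) * mprod es = I"
    using assms
  proof (induction es)
    case (Cons e es)
    note c = Cons.prems[unfolded clifford_Cons]
    have [simp]: "e \<in> M" "mprod es \<in> M" "mat_adjoint e = - e" using c by auto
    have ee: "e * (e * A) = - A" if "A \<in> M" for A
      using mult_left_eq[of e e "- I" A] c that by simp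
    have "e * mprod es = (- 1) ^ length es \<cdot>\<^sub>m (mprod es * e)"
      using anticommute_mprod[of e es] c by (auto dest: cliffordD)
    then have "mprod es * e = (- 1) ^ length es \<cdot>\<^sub>m (e * mprod es)"
      by (simp flip: power_add mult_2)
    then have "mprod es * (e * mprod es) = (- 1) ^ length es \<cdot>\<^sub>m (e * (mprod es * mprod es))"
      using mult_left_eq[of "mprod es" e _ "mprod es"] by simp
    then have "e * (mprod es * (e * mprod es)) = (- ((- 1) ^ length es)) \<cdot>\<^sub>m (mprod es * mprod es)"
      by (simp add: ee)
    then show ?case
      using Cons.IH c by (cases "even (length es)") (auto simp: ee )
  qed simp
  then show "mprod es * mprod es = I \<or> mprod es * mprod es = - I"
    "mat_adjoint (mprod es) * mprod es = I" by auto
qed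

text \<open>A unitary with square \<open>I\<close> is Hermitian and one with square
  \<open>- I\<close> is skew-Hermitian; accordingly \<open>w\<close> is 1 or
  \<open>\<i>\<close>.\<close>

lemma mprod_involution:
  assumes "clifford es"
  obtains w where "w \<noteq> 0" "mat_adjoint (w \<cdot>\<^sub>m mprod es) = w \<cdot>\<^sub>m mprod es"
    "(w \<cdot>\<^sub>m mprod es) * (w \<cdot>\<^sub>m mprod es) = I"
proof -
  note [simp] = clifford_mprod_carrier[OF assms]
  note adj = mult_left_eq[OF mprod_square(2)[OF assms], of "mprod es"]
  show thesis
  proof (cases "mprod es * mprod es = I")
    case True
    then have "mat_adjoint (mprod es) = mprod es" using adj by simp
    then show thesis using True that[of 1] by simp
  next
    case False
    then have sq: "mprod es * mprod es = - I" using mprod_square(1)[OF assms] by blast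
    then have "- mat_adjoint (mprod es) = mprod es" using adj by simp
    then have "mat_adjoint (mprod es) = - mprod es" by (metis uminus_uminus_mat)
    then show thesis using sq that[of \<i>] by simp
  qed
qed

lemma eq_uminus_iff:
  assumes "A \<in> M"
  shows "A = - A \<longleftrightarrow> A = 0\<^sub>m n n"
proof
  assume eq: "A = - A"
  show "A = 0\<^sub>m n n"
  proof (rule eq_matI)
    fix i j assume "i < dim_row (0\<^sub>m n n)" "j < dim_col (0\<^sub>m n n)"
    then show "A $$ (i, j) = 0\<^sub>m n n $$ (i, j)"
      using arg_cong[OF eq, of "\<lambda>X. X $$ (i, j)"] assms by simp
  qed (use assms in auto)
qed (auto intro!: eq_matI)

lemma add_eq_diff_D:
  assumes "A \<in> M" "X \<in> M" "A + - X = A + X"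
  shows "X = 0\<^sub>m n n"
proof (rule eq_matI)
  fix i j assume "i < dim_row (0\<^sub>m n n)" "j < dim_col (0\<^sub>m n n)"
  then show "X $$ (i, j) = 0\<^sub>m n n $$ (i, j)"
    using arg_cong[OF assms(3), of "\<lambda>X. X $$ (i, j)"] assms(1,2) by auto
qed (use assms in auto)

text \<open>The product of an odd number of generators commutes with each of them and scales to a
  Hermitian involution \<open>N\<close>. Since \<open>y\<close> anticommutes with \<open>N\<close>,
  the latter is neither \<open>I\<close> nor \<open>- I\<close>. Dropping one generator leaves the
  even case with \<open>N\<close> as \<open>D\<close>.\<close>

lemma commutant_odd:
  assumes es: "clifford es" "length es = Suc (2 * l)" and n: "n = 2 ^ Suc l"
    and y: "y \<in> M" "y \<noteq> 0\<^sub>m n n" "\<forall>e\<in>set es. y * e = - (e * y)"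
    and X: "X \<in> M" "\<forall>e\<in>set es. e * X = X * e"
  shows "\<exists>\<alpha> \<beta>. X = \<alpha> \<cdot>\<^sub>m I + \<beta> \<cdot>\<^sub>m mprod es"
proof -
  note [simp] = y(1) X(1) clifford_mprod_carrier[OF es(1)]
  have sub: "set es \<subseteq> M" using es(1) by (auto dest: cliffordD)
  obtain w where w: "w \<noteq> 0" "mat_adjoint (w \<cdot>\<^sub>m mprod es) = w \<cdot>\<^sub>m mprod es"
    "(w \<cdot>\<^sub>m mprod es) * (w \<cdot>\<^sub>m mprod es) = I"
    using mprod_involution[OF es(1)] by blast
  define N where "N = w \<cdot>\<^sub>m mprod es"
  have yN: "y * N = - (N * y)"
    using anticommute_mprod[of y es] y sub es(2) by (simp add: N_def)
  have ne: "N \<noteq> I" "N \<noteq> - I"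
    using yN eq_uminus_iff[of y] y(2) by auto
  have tl: "clifford (tl es)" "length (tl es) = 2 * l" "set (tl es) \<subseteq> set es"
    using es by (cases es; auto simp: clifford_Cons)+
  have "\<forall>e\<in>set es. e * N = N * e"
    using generator_mprod[OF es(1)] es(2) sub by (auto simp: N_def)
  moreover have "X * N = N * X"
    using commute_mprod[of X es] X sub by (simp add: N_def)
  moreover have "N \<in> M" by (simp add: N_def)
  ultimately obtain x z where "X = x \<cdot>\<^sub>m I + z \<cdot>\<^sub>m N"
    using commutant_even[OF tl(1,2) n, of N X] w(2,3)[folded N_def] ne tl(3) X by blast
  then show ?thesis unfolding N_def by auto
qed

lemma smult_I_cancel:
  assumes "n > 0" "c \<cdot>\<^sub>m I = d \<cdot>\<^sub>m I"
  shows "c = d"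
  using arg_cong[OF assms(2), of "\<lambda>X. X $$ (0, 0)"] assms(1) by simp

text \<open>A relation with \<open>v \<noteq> 0\<close> would make \<open>D\<close> a scalar matrix
  whose scalar squares to 1.\<close>

lemma involution_independent:
  assumes "n > 0" "D \<in> M" "D * D = I" "D \<noteq> I" "D \<noteq> - I" "u \<cdot>\<^sub>m I + v \<cdot>\<^sub>m D = 0\<^sub>m n n"
  shows "u = 0" "v = 0"
proof -
  have eq: "u \<cdot>\<^sub>m I = (- v) \<cdot>\<^sub>m D"
    using assms(2,6) add_eq_0_iff[of "u \<cdot>\<^sub>m I" "v \<cdot>\<^sub>m D"] by simp
  show v: "v = 0"
  proof (rule ccontr)
    assume v: "v \<noteq> 0"
    define w where "w = - u / v"
    have D: "D = w \<cdot>\<^sub>m I"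
      using arg_cong[OF eq, of "\<lambda>A. (- 1 / v) \<cdot>\<^sub>m A"] v by (simp add: w_def)
    then have "(w * w) \<cdot>\<^sub>m I = 1 \<cdot>\<^sub>m I" using assms(3) by simp
    then have "w * w = 1" by (rule smult_I_cancel[OF assms(1)])
    then have "w = 1 \<or> w = - 1" by (simp add: square_eq_1_iff)
    then show False using D assms(4,5) by auto
  qed
  then have "u \<cdot>\<^sub>m I = 0 \<cdot>\<^sub>m I" using eq assms(2) by (auto intro!: eq_matI)
  then show "u = 0" by (rule smult_I_cancel[OF assms(1)])
qed

end

section \<open>Two families of anticommuting weights\<close>

text \<open>This collects what the code conditions give for all symbols but the first once its
  in-phase weight is the identity; \<open>neq\<close> is the contribution of linear
  independence.\<close>

locale clifford_pair = square_mats n for n +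
  fixes a :: nat and B C :: "nat \<Rightarrow> complex mat"
  assumes a: "a \<ge> 2" and n: "n = 2 ^ a"
    and B: "\<And>i. i \<in> {2..2*a} \<Longrightarrow> B i \<in> M" "\<And>i. i \<in> {2..2*a} \<Longrightarrow> mat_adjoint (B i) = - B i"
      "\<And>i. i \<in> {2..2*a} \<Longrightarrow> B i * B i = - I"
    and C: "\<And>i. i \<in> {2..2*a} \<Longrightarrow> C i \<in> M" "\<And>i. i \<in> {2..2*a} \<Longrightarrow> C i * C i = - I"
    and BB: "\<And>i j. i \<in> {2..2*a} \<Longrightarrow> j \<in> {2..2*a} \<Longrightarrow> i \<noteq> j \<Longrightarrow> B i * B j = - (B j * B i)"
    and CC: "\<And>i j. i \<in> {2..2*a} \<Longrightarrow> j \<in> {2..2*a} \<Longrightarrow> i \<noteq> j \<Longrightarrow> C i * C j = - (C j * C i)"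
    and BC: "\<And>i j. i \<in> {2..2*a} \<Longrightarrow> j \<in> {2..2*a} \<Longrightarrow> i \<noteq> j \<Longrightarrow> B i * C j = - (C j * B i)"
    and neq: "\<And>i. i \<in> {2..2*a} \<Longrightarrow> C i \<noteq> B i" "\<And>i. i \<in> {2..2*a} \<Longrightarrow> C i \<noteq> - B i"
begin

lemma n_pos: "n > 0"
  by (simp add: n)

lemma n_Suc: "n = 2 ^ Suc (a - 1)"
  using a by (simp add: n flip: power_Suc)

lemma B_B_mult: "i \<in> {2..2*a} \<Longrightarrow> A \<in> M \<Longrightarrow> B i * (B i * A) = - A"
  using mult_left_eq[of "B i" "B i" "- I" A] B by simp

lemma clifford_map_B:
  assumes "distinct xs" "set xs \<subseteq> {2..2*a}"
  shows "clifford (map B xs)"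
  using assms
proof (induction xs)
  case (Cons x xs)
  then have "\<forall>y\<in>set xs. B x * B y = - (B y * B x)"
    by (intro ballI BB) auto
  then show ?case using B[of x] Cons by (auto simp: clifford_Cons)
qed (simp add: clifford_def)

text \<open>Both squares are \<open>- I\<close>, so \<open>x * x = 1\<close>; excluding the factors
  1 and -1 thus excludes all complex factors.\<close>

lemma not_multiple:
  assumes i: "i \<in> {2..2*a}"
  shows "C i \<noteq> x \<cdot>\<^sub>m B i"
proof
  assume eq: "C i = x \<cdot>\<^sub>m B i"
  then have "- I = (x * x) \<cdot>\<^sub>m (- I)" using B[OF i] C[OF i] by simp
  then have "1 \<cdot>\<^sub>m I = (x * x) \<cdot>\<^sub>m I" by (metis uminus_smult(2) uminus_smult(1) uminus_uminus_mat one_smult)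
  then have "x * x = 1" using smult_I_cancel[OF n_pos] by metis
  then have "x = 1 \<or> x = - 1" by (simp add: square_eq_1_iff)
  then show False using eq neq[OF i] by auto
qed

text \<open>The quotient of \<open>C i\<close> by \<open>B i\<close>, because \<open>- B i\<close>
  is the inverse of \<open>B i\<close>.\<close>

definition ratio :: "nat \<Rightarrow> complex mat" where
  "ratio i = - (B i * C i)"

lemma ratio_carrier: "i \<in> {2..2*a} \<Longrightarrow> ratio i \<in> M"
  using B C by (simp add: ratio_def)

lemma B_ratio: "i \<in> {2..2*a} \<Longrightarrow> B i * ratio i = C i"
  using B C by (simp add: ratio_def B_B_mult)

lemma ratio_commute:
  assumes i: "i \<in> {2..2*a}" and e: "e \<in> M" "e * B i = - (B i * e)" "e * C i = - (C i * e)"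
  shows "e * ratio i = ratio i * e"
  using mult_left_eq[OF e(2), of "C i"] e B[OF i] C[OF i] by (simp add: ratio_def)

lemma ratio_commute_B:
  assumes "i \<in> {2..2*a}" "j \<in> {2..2*a}" "i \<noteq> j"
  shows "B j * ratio i = ratio i * B j"
  using assms(3)
  by (intro ratio_commute[OF assms(1) B(1)[OF assms(2)] BB[OF assms(2,1)] BC[OF assms(2,1)]]) auto

text \<open>The quotient commutes with \<open>D\<close> and with the \<open>2a - 2\<close>
  generators \<open>B j\<close>, \<open>j \<noteq> i\<close>, so it is \<open>x I + y D\<close>. Its
  square is \<open>I\<close>, which forces \<open>x * x + y * y = 1\<close> and
  \<open>2 * x * y = 0\<close>; the case \<open>y = 0\<close> would make \<open>C i\<close> a
  multiple of \<open>B i\<close>.\<close>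

lemma C_eq_plus_minus:
  assumes D: "D \<in> M" "mat_adjoint D = D" "D * D = I" "D \<noteq> I" "D \<noteq> - I"
    and BD: "\<And>i. i \<in> {2..2*a} \<Longrightarrow> B i * D = D * B i"
    and CD: "\<And>i. i \<in> {2..2*a} \<Longrightarrow> C i * D = D * C i"
    and i: "i \<in> {2..2*a}"
  shows "C i = B i * D \<or> C i = - (B i * D)"
proof -
  note [simp] = D(1-3) B(1)[OF i] C(1)[OF i] ratio_carrier[OF i] BD[OF i, symmetric]
  define js where "js = remove1 i [2..<Suc (2*a)]"
  have js: "distinct js" "set js = {2..2*a} - {i}" "length js = 2 * (a - 1)"
    using i a by (auto simp: js_def length_remove1)
  have "ratio i * D = D * ratio i"
    using mult_left_eq[OF BD[OF i, symmetric], of "C i"] CD[OF i] by (simp add: ratio_def)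
  then obtain x y where xy: "ratio i = x \<cdot>\<^sub>m I + y \<cdot>\<^sub>m D"
    using commutant_even[OF _ _ n_Suc, of "map B js" D "ratio i"] js clifford_map_B[of js] D BD
      ratio_commute_B[OF i] by auto
  have Bi: "B i * ratio i = ratio i * B i" by (simp add: xy distribs)
  have "C i * C i = (B i * ratio i) * (B i * ratio i)" by (simp only: B_ratio[OF i])
  also have "\<dots> = - (ratio i * ratio i)"
    using mult_left_eq[OF Bi[symmetric], of "ratio i"] B_B_mult[OF i] by simp
  finally have sq: "ratio i * ratio i = I" using C(2)[OF i] by simp
  have "(x * x + y * y - 1) \<cdot>\<^sub>m I + (2 * x * y) \<cdot>\<^sub>m D
      = (x \<cdot>\<^sub>m I + y \<cdot>\<^sub>m D) * (x \<cdot>\<^sub>m I + y \<cdot>\<^sub>m D) - I"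
    by (simp add: distribs) (use carrier_matD[OF D(1)] in \<open>auto intro!: eq_matI simp: algebra_simps\<close>)
  also have "\<dots> = 0\<^sub>m n n" using sq unfolding xy by simp
  finally have "x * x + y * y - 1 = 0" "2 * x * y = 0"
    using involution_independent[OF n_pos D(1,3-5)] by blast+
  moreover have Ci: "C i = x \<cdot>\<^sub>m B i + y \<cdot>\<^sub>m (B i * D)"
    by (subst B_ratio[OF i, symmetric]) (simp add: xy distribs del: BD)
  moreover have "y \<noteq> 0"
  proof
    assume "y = 0"
    then have "C i = x \<cdot>\<^sub>m B i"
      unfolding Ci using carrier_matD[OF B(1)[OF i]] carrier_matD[OF D(1)] by (auto intro!: eq_matI)
    then show False using not_multiple[OF i] by simp
  qed
  ultimately have "x = 0" "y * y = 1" by auto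
  then have y: "y = 1 \<or> y = - 1" by (simp add: square_eq_1_iff)
  have "C i = y \<cdot>\<^sub>m (B i * D)"
    unfolding Ci \<open>x = 0\<close> using carrier_matD[OF B(1)[OF i]] carrier_matD[OF D(1)]
    by (auto intro!: eq_matI)
  then show ?thesis using y by auto
qed

section \<open>Vanishing of skew-Hermitian matrices that anticommute with all weights\<close>

text \<open>The square of \<open>F\<close> commutes with all \<open>B i\<close>, so it lies in the
  span of \<open>I\<close> and their product \<open>G\<close>. As \<open>F\<close> commutes with its
  own square but anticommutes with \<open>G\<close>, the \<open>G\<close> term vanishes.\<close>

lemma anticommuting_skew_scalar_square:
  assumes F: "F \<in> M" "mat_adjoint F = - F" "F \<noteq> 0\<^sub>m n n"
    and FB: "\<And>i. i \<in> {2..2*a} \<Longrightarrow> F * B i = - (B i * F)"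
  obtains r :: real where "r > 0" "F * F = of_real (- r) \<cdot>\<^sub>m I"
proof -
  note [simp] = F(1,2)
  define es where "es = map B [2..<Suc (2*a)]"
  have es: "clifford es" unfolding es_def by (rule clifford_map_B) auto
  have len: "length es = Suc (2 * (a - 1))" using a by (simp add: es_def)
  have Fe: "\<forall>e\<in>set es. F * e = - (e * F)" by (auto simp: es_def FB)
  have "e * (F * F) = F * F * e" if "e \<in> set es" for e
  proof -
    have [simp]: "e \<in> M" using cliffordD[OF es that] by simp
    have eF: "e * F = - (F * e)" using Fe that by simp
    show ?thesis using mult_left_eq[OF eF, of F] eF by simp
  qed
  then obtain \<alpha> \<beta> where FF: "F * F = \<alpha> \<cdot>\<^sub>m I + \<beta> \<cdot>\<^sub>m mprod es"
    using commutant_odd[OF es len n_Suc F(1,3) Fe, of "F * F"] by auto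
  define G where "G = mprod es"
  have [simp]: "G \<in> M" using es by (simp add: G_def)
  have FG: "F * G = - (G * F)"
    using anticommute_mprod[of F es] Fe len cliffordD(1)[OF es] by (simp add: G_def subset_iff)
  have "F * (F * F) = F * F * F" by simp
  then have "\<alpha> \<cdot>\<^sub>m F + (- \<beta>) \<cdot>\<^sub>m (G * F) = \<alpha> \<cdot>\<^sub>m F + \<beta> \<cdot>\<^sub>m (G * F)"
    unfolding FF G_def[symmetric] by (simp add: distribs FG)
  then have "\<beta> \<cdot>\<^sub>m (G * F) = 0\<^sub>m n n"
    by (intro add_eq_diff_D[of "\<alpha> \<cdot>\<^sub>m F"]) simp_all
  then have "mat_adjoint G * (\<beta> \<cdot>\<^sub>m (G * F)) = 0\<^sub>m n n" by simp
  then have "\<beta> \<cdot>\<^sub>m F = 0\<^sub>m n n"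
    using mult_left_eq[OF mprod_square(2)[OF es, folded G_def], of F] by simp
  then have "\<beta> = 0" using F(3) smult_eq_iff[of F "0\<^sub>m n n" \<beta>] by auto
  then have FF: "F * F = \<alpha> \<cdot>\<^sub>m I"
    unfolding FF G_def[symmetric] using carrier_matD[of G n n] by (auto intro!: eq_matI)
  \<comment> \<open>The squared Frobenius norm of \<open>F\<close>. Taking traces in
    \<open>F * F = \<alpha> I\<close> gives \<open>- \<alpha> n = t\<close>, so \<open>r\<close> is
    \<open>t / n\<close>.\<close>
  define t where "t = (\<Sum>i<n. \<Sum>j<n. (cmod (F $$ (j, i)))\<^sup>2)"
  have t: "- \<alpha> * of_nat n = of_real t" using trace_gram[of F] FF by (simp add: t_def)
  have "t = Re (mtrace (mat_adjoint F * F))" unfolding trace_gram[OF F(1)] t_def by simp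
  then have "t > 0"
    using Re_trace_gram_nonneg[of F] trace_gram_eq_0_D[of F] F(1,3) by (metis less_eq_real_def)
  show thesis
  proof (rule that)
    show "t / n > 0" using \<open>t > 0\<close> n_pos by simp
    have "\<alpha> = - (- \<alpha> * of_nat n) / of_nat n" using n_pos by simp
    then have "\<alpha> = of_real (- (t / n))" unfolding t by simp
    then show "F * F = of_real (- (t / n)) \<cdot>\<^sub>m I" using FF by simp
  qed
qed

text \<open>The matrix \<open>F\<close> and the \<open>B j\<close> with \<open>j \<noteq> i\<close>
  form an odd family of \<open>2a - 1\<close> generators commuting with the quotient;
  \<open>B i\<close> serves as the nonzero matrix anticommuting with all of them.\<close>

lemma C_in_span:
  assumes F: "F \<in> M" "mat_adjoint F = - F" "F * F = - I"
    and FB: "\<And>i. i \<in> {2..2*a} \<Longrightarrow> F * B i = - (B i * F)"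
    and FC: "\<And>i. i \<in> {2..2*a} \<Longrightarrow> F * C i = - (C i * F)"
    and i: "i \<in> {2..2*a}" and js: "distinct js" "set js = {2..2*a} - {i}"
  shows "\<exists>\<alpha> \<beta>. C i = \<alpha> \<cdot>\<^sub>m B i + \<beta> \<cdot>\<^sub>m (B i * (F * mprod (map B js)))"
proof -
  note [simp] = F(1) B(1)[OF i] C(1)[OF i]
  define es where "es = F # map B js"
  have cl: "clifford (map B js)" using js by (intro clifford_map_B) auto
  then have es: "clifford es" using F FB js by (auto simp: es_def clifford_Cons)
  have "length js = 2 * a - 1 - 1"
    using distinct_card[OF js(1)] i js(2) by simp
  then have len: "length es = Suc (2 * (a - 1))" using a by (simp add: es_def)
  have "B i \<noteq> 0\<^sub>m n n"
  proof
    assume "B i = 0\<^sub>m n n"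
    then have "0\<^sub>m n n = - I" using B(3)[OF i] by simp
    from arg_cong[OF this, of "\<lambda>X. X $$ (0, 0)"] show False using n_pos by simp
  qed
  moreover have "\<forall>e\<in>set es. B i * e = - (e * B i)"
    using FB[OF i] BB[OF i] js by (auto simp: es_def)
  moreover have "\<forall>e\<in>set es. e * ratio i = ratio i * e"
    using ratio_commute_B[OF i] ratio_commute[OF i F(1) FB[OF i] FC[OF i]] js by (auto simp: es_def)
  ultimately obtain \<alpha> \<beta> where "ratio i = \<alpha> \<cdot>\<^sub>m I + \<beta> \<cdot>\<^sub>m mprod es"
    using commutant_odd[OF es len n_Suc, of "B i" "ratio i"] ratio_carrier[OF i] by auto
  then have "B i * ratio i = \<alpha> \<cdot>\<^sub>m B i + \<beta> \<cdot>\<^sub>m (B i * (F * mprod (map B js)))"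
    using clifford_mprod_carrier[OF cl] by (simp add: distribs es_def)
  then show ?thesis unfolding B_ratio[OF i] by blast
qed

lemma anticommuting_skew_zero:
  assumes F: "F \<in> M" "mat_adjoint F = - F"
    and FB: "\<And>i. i \<in> {2..2*a} \<Longrightarrow> F * B i = - (B i * F)"
    and FC: "\<And>i. i \<in> {2..2*a} \<Longrightarrow> F * C i = - (C i * F)"
  shows "F = 0\<^sub>m n n"
proof (rule ccontr)
  assume "F \<noteq> 0\<^sub>m n n"
  then obtain r :: real where r: "r > 0" "F * F = of_real (- r) \<cdot>\<^sub>m I"
    using anticommuting_skew_scalar_square[OF F _ FB] by blast
  \<comment> \<open>The factor is real, so \<open>E\<close> stays skew-Hermitian, and it is chosen
    to give \<open>E * E = - I\<close>.\<close>
  define E where "E = of_real (1 / sqrt r) \<cdot>\<^sub>m F"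
  have s: "complex_of_real (1 / sqrt r) * of_real (1 / sqrt r) * of_real (- r) = - 1"
    using r(1) by (simp flip: of_real_mult)
  have E: "E \<in> M" "mat_adjoint E = - E" using F by (simp_all add: E_def)
  have "E * E = (complex_of_real (1 / sqrt r) * of_real (1 / sqrt r) * of_real (- r)) \<cdot>\<^sub>m I"
    using F r(2) by (simp add: E_def)
  then have EE: "E * E = - I" unfolding s by simp
  have EB: "E * B i = - (B i * E)" and EC: "E * C i = - (C i * E)" if "i \<in> {2..2*a}" for i
    using FB[OF that] FC[OF that] B[OF that] C[OF that] F by (simp_all add: E_def)
  have i2: "2 \<in> {2..2*a}" and i3: "3 \<in> {2..2*a}" using a by auto
  define ks where "ks = [4..<Suc (2*a)]"
  define R where "R = mprod (map B ks)"
  \<comment> \<open>The product of all \<open>2a\<close> generators, ordered so that both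
    \<open>C 2\<close> and \<open>C 3\<close> can be expressed through it.\<close>
  define Z where "Z = B 2 * (E * (B 3 * R))"
  have R: "R \<in> M" unfolding R_def ks_def by (intro clifford_mprod_carrier clifford_map_B) auto
  note [simp] = E(1) B(1)[OF i2] B(1)[OF i3] R
  have Z [simp]: "Z \<in> M" by (simp add: Z_def)
  have ks: "distinct (3 # ks)" "set (3 # ks) = {2..2*a} - {2}"
    "distinct (2 # ks)" "set (2 # ks) = {2..2*a} - {3}"
    using a by (auto simp: ks_def) presburger
  obtain \<alpha> \<beta> where C2: "C 2 = \<alpha> \<cdot>\<^sub>m B 2 + \<beta> \<cdot>\<^sub>m Z"
    using C_in_span[OF E EE EB EC i2 ks(1,2)] by (auto simp: Z_def R_def)
  obtain \<alpha>' \<gamma> where C3: "C 3 = \<alpha>' \<cdot>\<^sub>m B 3 + \<gamma> \<cdot>\<^sub>m (B 3 * (E * (B 2 * R)))"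
    using C_in_span[OF E EE EB EC i3 ks(3,4)] by (auto simp: R_def)
  have swap: "B 3 * B 2 = - (B 2 * B 3)" "B 3 * E = - (E * B 3)" "E * B 2 = - (B 2 * E)"
    using BB[OF i3 i2] EB[OF i2] EB[OF i3] by simp_all
  have swap': "B 3 * (B 2 * A) = - (B 2 * (B 3 * A))" "B 3 * (E * A) = - (E * (B 3 * A))"
    "E * (B 2 * A) = - (B 2 * (E * A))" if "A \<in> M" for A
    using mult_left_eq[OF swap(1), of A] mult_left_eq[OF swap(2), of A]
      mult_left_eq[OF swap(3), of A] that by simp_all
  \<comment> \<open>Reversing \<open>B 3\<close>, \<open>E\<close>, \<open>B 2\<close> to
    \<open>B 2\<close>, \<open>E\<close>, \<open>B 3\<close> takes three transpositions, hence the
    minus sign.\<close>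
  define \<beta>' where "\<beta>' = - \<gamma>"
  have C3: "C 3 = \<alpha>' \<cdot>\<^sub>m B 3 + \<beta>' \<cdot>\<^sub>m Z"
    unfolding C3 by (simp add: swap' Z_def \<beta>'_def)
  define zs where "zs = B 2 # E # map B (3 # ks)"
  have Z_mprod: "mprod zs = Z" by (simp add: Z_def R_def zs_def)
  have len: "length zs = 2 * a" using a by (simp add: zs_def ks_def)
  have cl: "clifford zs"
    unfolding zs_def clifford_Cons
  proof (intro conjI ballI)
    fix f assume "f \<in> set (E # map B (3 # ks))"
    then consider "f = E" | j where "f = B j" "j \<in> set (3 # ks)" by auto
    then show "B 2 * f = - (f * B 2)"
    proof cases
      case 1
      then show ?thesis using EB[OF i2] by simp
    next
      case (2 j)
      then show ?thesis using BB[OF i2, of j] ks(2) by blast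
    qed
  next
    fix f assume "f \<in> set (map B (3 # ks))"
    then obtain j where "f = B j" "j \<in> set (3 # ks)" by auto
    then show "E * f = - (f * E)" using EB[of j] ks(2) by blast
  qed (use B[OF i2] E EE clifford_map_B[OF ks(1)] ks(2) in blast)+
  \<comment> \<open>The number of factors is even, so every generator anticommutes with the full
    product.\<close>
  have gen: "e * Z = - (Z * e)" if "e \<in> set zs" for e
    using generator_mprod[OF cl that] by (simp add: len Z_mprod)
  have BZ: "B 2 * Z = - (Z * B 2)" "B 3 * Z = - (Z * B 3)"
    by (rule gen, simp add: zs_def)+
  \<comment> \<open>In \<open>C 2 * C 3 = - (C 3 * C 2)\<close> the terms from distinct
    anticommuting factors agree on both sides. Only the term in \<open>Z * Z\<close> changes sign,
    so it must vanish.\<close>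
  have collect: "c \<cdot>\<^sub>m X = 0\<^sub>m n n"
    if "A1 + A2 + (A3 + c \<cdot>\<^sub>m X) = - (- A1 + - A3 + (- A2 + c \<cdot>\<^sub>m X))"
      and [simp]: "A1 \<in> M" "A2 \<in> M" "A3 \<in> M" "X \<in> M" for A1 A2 A3 X c
  proof (rule eq_matI)
    fix i j assume "i < dim_row (0\<^sub>m n n)" "j < dim_col (0\<^sub>m n n)"
    then show "(c \<cdot>\<^sub>m X) $$ (i, j) = 0\<^sub>m n n $$ (i, j)"
      using arg_cong[OF that(1), of "\<lambda>X. X $$ (i, j)"] carrier_matD[OF that(2)] carrier_matD[OF that(3)]
        carrier_matD[OF that(4)] carrier_matD[OF that(5)] by auto
  qed (use carrier_matD[OF that(5)] in auto)
  define A1 where "A1 = (\<alpha> * \<alpha>') \<cdot>\<^sub>m (B 2 * B 3)"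
  define A2 where "A2 = (\<alpha> * \<beta>') \<cdot>\<^sub>m (B 2 * Z)"
  define A3 where "A3 = (\<beta> * \<alpha>') \<cdot>\<^sub>m (Z * B 3)"
  have [simp]: "A1 \<in> M" "A2 \<in> M" "A3 \<in> M" by (simp_all add: A1_def A2_def A3_def)
  have "C 2 * C 3 = A1 + A3 + (A2 + (\<beta> * \<beta>') \<cdot>\<^sub>m (Z * Z))"
    by (simp add: C2 C3 distribs A1_def A2_def A3_def mult.commute)
  moreover have "C 3 * C 2 = - A1 + - A2 + (- A3 + (\<beta> * \<beta>') \<cdot>\<^sub>m (Z * Z))"
    by (simp add: C2 C3 distribs A1_def A2_def A3_def swap BZ mult.commute)
  moreover have "C 2 * C 3 = - (C 3 * C 2)" using CC[OF i2 i3] by simp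
  ultimately have "(\<beta> * \<beta>') \<cdot>\<^sub>m (Z * Z) = 0\<^sub>m n n"
    by (intro collect[of A1 A3 A2]) simp_all
  moreover have "Z * Z = I \<or> Z * Z = - I"
    using mprod_square(1)[OF cl, unfolded Z_mprod] .
  ultimately have "(\<beta> * \<beta>') \<cdot>\<^sub>m I = 0 \<cdot>\<^sub>m I \<or> (- (\<beta> * \<beta>')) \<cdot>\<^sub>m I = 0 \<cdot>\<^sub>m I"
    by (auto intro!: eq_matI)
  then have "\<beta> * \<beta>' = 0"
    using smult_I_cancel[OF n_pos] by (metis neg_equal_0_iff_equal)
  then consider "\<beta> = 0" | "\<beta>' = 0" by auto
  then show False
  proof cases
    case 1
    then have "C 2 = \<alpha> \<cdot>\<^sub>m B 2"
      unfolding C2 using carrier_matD[OF Z] carrier_matD[OF B(1)[OF i2]] by (auto intro!: eq_matI)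
    then show False using not_multiple[OF i2] by simp
  next
    case 2
    then have "C 3 = \<alpha>' \<cdot>\<^sub>m B 3"
      unfolding C3 using carrier_matD[OF Z] carrier_matD[OF B(1)[OF i3]] by (auto intro!: eq_matI)
    then show False using not_multiple[OF i3] by simp
  qed
qed

end

section \<open>From the code conditions to the weight families\<close>

lemma lin_indep_not_multiple:
  fixes r :: real
  assumes ind: "real_lin_indep_weights n k AI AQ" and i: "i \<in> {1..k}" and A: "AI i \<in> carrier_mat n n"
  shows "AQ i \<noteq> of_real r \<cdot>\<^sub>m AI i"
proof
  assume eq: "AQ i = of_real r \<cdot>\<^sub>m AI i"
  define c where "c j = (if j = i then r else 0)" for j
  define d where "d j = (if j = i then - 1 else 0 :: real)" for j
  have "(\<Sum>j\<in>{1..k}. complex_of_real (c j) * AI j $$ (s,t) + complex_of_real (d j) * AQ j $$ (s,t)) = 0"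
    if "s < n" "t < n" for s t
    using that A by (intro sum.neutral) (auto simp: c_def d_def eq)
  then have "d i = 0" using ind i unfolding real_lin_indep_weights_def by blast
  then show False by (simp add: d_def)
qed

theorem theorem2:
  fixes a :: nat and AI AQ :: "nat \<Rightarrow> complex mat"
  assumes "a \<ge> 2"
    and "unitary_weight_SSD (2^a) (2*a) AI AQ"
    and "normalized_STBC (2^a) AI"
  shows "AQ 1 = mat_adjoint (AQ 1) \<and> AQ 1 * AQ 1 = 1\<^sub>m (2^a) \<and>
         (\<forall>i\<in>{2..2*a}. AI i * AQ 1 = AQ 1 * AI i \<and>
            (AQ i = AI i * AQ 1 \<or> AQ i = - (AI i * AQ 1)))"
proof -
  define n where "n = (2::nat) ^ a"
  interpret square_mats n .
  note ssd = assms(2)[folded n_def, unfolded unitary_weight_SSD_def]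
  have A1: "AI 1 = I" using assms(3) by (simp add: normalized_STBC_def n_def)
  have car: "AI i \<in> M" "AQ i \<in> M" if "i \<in> {1..2*a}" for i using ssd that by auto
  have unit: "mat_adjoint (AI i) * AI i = I" "mat_adjoint (AQ i) * AQ i = I" if "i \<in> {1..2*a}" for i
    using ssd that by auto
  have ind: "real_lin_indep_weights n (2*a) AI AQ" using ssd by auto
  have ortho: "mat_adjoint (AI i) * AQ j = - (mat_adjoint (AQ j) * AI i)"
    "mat_adjoint (AI i) * AI j = - (mat_adjoint (AI j) * AI i)"
    "mat_adjoint (AQ i) * AQ j = - (mat_adjoint (AQ j) * AQ i)"
    if "i \<in> {1..2*a}" "j \<in> {1..2*a}" "i \<noteq> j" for i j
    using ssd that car by (simp_all add: add_eq_0_iff[symmetric])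
  have one: "1 \<in> {1..2*a}" using assms(1) by simp
  have sub: "i \<in> {1..2*a}" "i \<noteq> 1" if "i \<in> {2..2*a}" for i using that by auto
  \<comment> \<open>Orthogonality to the identity, the in-phase weight of the first symbol, is
    skewness.\<close>
  have skew: "mat_adjoint (AI i) = - AI i" "mat_adjoint (AQ i) = - AQ i" if "i \<in> {2..2*a}" for i
    using arg_cong[OF ortho(2)[OF one sub(1)[OF that]], of uminus]
      arg_cong[OF ortho(1)[OF one sub(1)[OF that]], of uminus] sub[OF that] car[OF sub(1)[OF that]] A1
    by auto
  define D where "D = AQ 1"
  have D [simp]: "D \<in> M" "mat_adjoint D * D = I" using car[OF one] unit[OF one] by (auto simp: D_def)
  have neq_weights: "AQ i \<noteq> AI i" "AQ i \<noteq> - AI i" if "i \<in> {1..2*a}" for i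
    using lin_indep_not_multiple[OF ind that car(1)[OF that], of 1]
      lin_indep_not_multiple[OF ind that car(1)[OF that], of "- 1"]
    by simp_all
  interpret clifford_pair n a AI AQ
  proof
    fix i assume i: "i \<in> {2..2*a}"
    show "AI i * AI i = - I" "AQ i * AQ i = - I"
      using arg_cong[OF unit(1)[OF sub(1)[OF i]], of uminus]
        arg_cong[OF unit(2)[OF sub(1)[OF i]], of uminus] skew[OF i] car[OF sub(1)[OF i]]
      by simp_all
  next
    fix i j assume "i \<in> {2..2*a}" "j \<in> {2..2*a}" "i \<noteq> j"
    then show "AI i * AI j = - (AI j * AI i)" "AQ i * AQ j = - (AQ j * AQ i)"
      "AI i * AQ j = - (AQ j * AI i)"
      using ortho(2,3)[OF sub(1) sub(1), of j i] ortho(1)[OF sub(1) sub(1), of i j, THEN arg_cong[of _ _ uminus]]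
        skew car[OF sub(1)] by auto
  qed (use assms(1) car skew sub neq_weights in \<open>auto simp: n_def\<close>)
  \<comment> \<open>Multiplying the hypothesis by \<open>A\<close> on both sides and using
    \<open>A * A = - I\<close> gives the second relation.\<close>
  have twist: "mat_adjoint D * A = A * D \<and> D * A = A * mat_adjoint D"
    if A: "A \<in> M" "A * A = - I" "mat_adjoint D * A = A * D" for A
  proof -
    have AA: "A * (A * X) = - X" if "X \<in> M" for X
      using mult_left_eq[OF A(2), of X] that A(1) by simp
    have "- (A * mat_adjoint D) = A * (mat_adjoint D * A) * A" using A(1,2) by simp
    also have "\<dots> = A * (A * D) * A" unfolding A(3) ..
    also have "\<dots> = - (D * A)" using A(1) by (simp add: AA)
    finally show ?thesis using A(3) by simp
  qed
  \<comment> \<open>For a skew-Hermitian weight, orthogonality to \<open>D\<close> is exactly the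
    hypothesis of \<open>twist\<close>.\<close>
  have BD: "mat_adjoint D * AI i = AI i * D \<and> D * AI i = AI i * mat_adjoint D"
    and CD: "mat_adjoint D * AQ i = AQ i * D \<and> D * AQ i = AQ i * mat_adjoint D"
    if i: "i \<in> {2..2*a}" for i
  proof -
    note c = car[OF sub(1)[OF i]]
    have "AI i * D = mat_adjoint D * AI i" "AQ i * D = mat_adjoint D * AQ i"
      using ortho(1,3)[OF sub(1)[OF i] one sub(2)[OF i]]
      unfolding D_def[symmetric] skew[OF i] uminus_mult(1)[OF c(1) D(1)] uminus_mult(1)[OF c(2) D(1)]
        uminus_eq_mat by blast+
    note this[symmetric]
    then show "mat_adjoint D * AI i = AI i * D \<and> D * AI i = AI i * mat_adjoint D"
      "mat_adjoint D * AQ i = AQ i * D \<and> D * AQ i = AQ i * mat_adjoint D"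
      using twist[OF c(1) B(3)[OF i]] twist[OF c(2) C(2)[OF i]] by blast+
  qed
  have skew_diff: "X - Y = - (Y - X)" if "X \<in> M" "Y \<in> M" for X Y :: "complex mat"
    using that by (intro eq_matI) auto
  \<comment> \<open>Moving \<open>D\<close> past a weight exchanges it with its adjoint, so the
    difference anticommutes with every weight of the other symbols.\<close>
  have "D - mat_adjoint D = 0\<^sub>m n n"
  proof (rule anticommuting_skew_zero)
    show "mat_adjoint (D - mat_adjoint D) = - (D - mat_adjoint D)"
      using skew_diff[of "mat_adjoint D" D] by simp
    fix i assume i: "i \<in> {2..2*a}"
    show "(D - mat_adjoint D) * AI i = - (AI i * (D - mat_adjoint D))"
      "(D - mat_adjoint D) * AQ i = - (AQ i * (D - mat_adjoint D))"
      using BD[OF i] CD[OF i] car[OF sub(1)[OF i]]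
        skew_diff[of "AI i * mat_adjoint D" "AI i * D"] skew_diff[of "AQ i * mat_adjoint D" "AQ i * D"]
      by (simp_all add: distribs)
  qed simp
  then have adj: "mat_adjoint D = D" using minus_eq_0_iff[of D "mat_adjoint D"] by simp
  then have DD: "D * D = I" using D(2) by simp
  \<comment> \<open>The two weights of the first symbol are linearly independent over the reals, so
    both eigenspaces of \<open>D\<close> are nonzero.\<close>
  have neD: "D \<noteq> I" "D \<noteq> - I" using neq_weights[OF one] A1 by (auto simp: D_def)
  have comm: "AI i * D = D * AI i" "AQ i * D = D * AQ i" if "i \<in> {2..2*a}" for i
    using BD[OF that] CD[OF that] adj by simp_all
  show ?thesis
    using adj[symmetric] DD comm(1) C_eq_plus_minus[OF D(1) adj DD neD comm]
    unfolding D_def n_def by blast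
qed

end
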